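(* Let $\mathcal{A}\subseteq\mathcal{M}$ be a von Neumann subalgebra of a type $\mathrm{II}_1$ factor $\mathcal{M}$. Suppose that, given any $\varepsilon>0$ and any finite collection of elements $x_1,\ldots,x_n,y_1,\ldots,y_m\in\mathcal{M}$, there exists a unitary $v\in\mathcal{A}$ such that $$\|\mathbb{E}_{\mathcal{A}}(x_i v y_j)-\mathbb{E}_{\mathcal{A}}(x_i)\,v\,\mathbb{E}_{\mathcal{A}}(y_j)\|_2<\varepsilon\qquad\text{for all } 1\le i\le n,\ 1\le j\le m.$$ Then $\mathcal{A}$ is strongly singular in $\mathcal{M}$.
   Context: Let $\mathcal{M}$ be a type $\mathrm{II}_1$ factor with its unique faithful normal tracial state $tr$, and put $\|x\|_2=(tr(x^*x))^{1/2}$ for $x\in\mathcal{M}$. For a linear map $\phi:\mathcal{M}\to\mathcal{M}$ put $\|\phi\|_{\infty,2}=\sup\{\|\phi(x)\|_2 : x\in\mathcal{M},\ \|x\|\le 1\}$. For a von Neumann subalgebra $\mathcal{N}\subseteq\mathcal{M}$ (containing the unit of $\mathcal{M}$), $\mathbb{E}_{\mathcal{N}}$ denotes the unique trace preserving conditional expectation of $\mathcal{M}$ onto $\mathcal{N}$. A von Neumann subalgebra $\mathcal{A}\subseteq\mathcal{M}$ (not necessarily abelian) is called strongly singular if $$\|\mathbb{E}_{\mathcal{A}}-\mathbb{E}_{u\mathcal{A}u^*}\|_{\infty,2}\ge\|(I-\mathbb{E}_{\mathcal{A}})(u)\|_2$$ for all unitaries $u\in\mathcal{M}$. *)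

theory Defs
  imports "HOL-Analysis.Analysis"
begin

text \<open>
  Complex Hilbert spaces. The real structure of the type (norm, real inner product, completeness)
  is tied to the complex one by \<open>Re_cinner\<close> and \<open>scaleC_of_real\<close>, so the norm of
  \<open>x\<close> is the square root of \<open>cinner x x\<close>. The complex inner product is linear in the
  first argument.
\<close>

class complex_hilbert_space = real_inner + complete_space +
  fixes scaleC :: "complex \<Rightarrow> 'a \<Rightarrow> 'a"  (infixr "*\<^sub>C" 75)
    and cinner :: "'a \<Rightarrow> 'a \<Rightarrow> complex"
  assumes scaleC_add_right: "c *\<^sub>C (x + y) = c *\<^sub>C x + c *\<^sub>C y"
    and scaleC_add_left: "(c + d) *\<^sub>C x = c *\<^sub>C x + d *\<^sub>C x"
    and scaleC_scaleC: "c *\<^sub>C (d *\<^sub>C x) = (c * d) *\<^sub>C x"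
    and scaleC_of_real: "complex_of_real r *\<^sub>C x = r *\<^sub>R x"
    and cinner_add_left: "cinner (x + y) z = cinner x z + cinner y z"
    and cinner_scaleC_left: "cinner (c *\<^sub>C x) y = c * cinner x y"
    and cinner_commute: "cinner x y = cnj (cinner y x)"
    and Re_cinner: "Re (cinner x y) = inner x y"

lemma norm_scaleC:
  fixes x :: "'a::complex_hilbert_space"
  shows "norm (c *\<^sub>C x) = cmod c * norm x"
proof -
  have im: "Im (cinner x x) = 0"
    using cinner_commute[of x x] by (simp add: complex_eq_iff)
  have "cinner (c *\<^sub>C x) (c *\<^sub>C x) = c * cnj (c * cinner x x)"
    by (metis cinner_commute cinner_scaleC_left)
  also have "\<dots> = of_real ((cmod c)\<^sup>2 * Re (cinner x x))"
    by (simp add: complex_eq_iff im cmod_power2) (simp add: power2_eq_square algebra_simps)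
  finally have "inner (c *\<^sub>C x) (c *\<^sub>C x) = (cmod c)\<^sup>2 * inner x x"
    using Re_cinner by (metis Re_complex_of_real)
  then show ?thesis
    by (simp add: norm_eq_sqrt_inner real_sqrt_mult)
qed

text \<open>
  Operators are bounded real-linear maps; the complex-linear ones, which are the elements of B(H),
  form the set \<open>bounded_ops\<close>. The norm of \<^typ>\<open>'a \<Rightarrow>\<^sub>L 'a\<close> is the operator norm.
\<close>

type_synonym 'a op = "'a \<Rightarrow>\<^sub>L 'a"

definition bounded_ops :: "'a::complex_hilbert_space op set" where
  "bounded_ops = {T. \<forall>c x. blinfun_apply T (c *\<^sub>C x) = c *\<^sub>C blinfun_apply T x}"

lift_definition scaleC_op :: "complex \<Rightarrow> 'a::complex_hilbert_space op \<Rightarrow> 'a op"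
  is "\<lambda>c T x. c *\<^sub>C T x"
proof -
  fix c :: complex and T :: "'a \<Rightarrow> 'a"
  assume T: "bounded_linear T"
  have real: "c *\<^sub>C (r *\<^sub>R x) = r *\<^sub>R (c *\<^sub>C x)" for r and x :: 'a
    by (metis scaleC_of_real scaleC_scaleC mult.commute)
  have "bounded_linear (\<lambda>x::'a. c *\<^sub>C x)"
    by (rule bounded_linear_intro[where K = "cmod c"])
      (simp_all add: scaleC_add_right real norm_scaleC mult.commute)
  then show "bounded_linear (\<lambda>x. c *\<^sub>C T x)"
    using T by (rule bounded_linear_compose)
qed

text \<open>For \<open>T\<close> in \<open>bounded_ops\<close> the adjoint exists by the Riesz representation theorem.\<close>

definition adj :: "'a::complex_hilbert_space op \<Rightarrow> 'a op" where
  "adj T = (THE S. \<forall>x y. cinner (blinfun_apply T x) y = cinner x (blinfun_apply S y))"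

definition positive_op :: "'a::complex_hilbert_space op \<Rightarrow> bool" where
  "positive_op T \<longleftrightarrow> T \<in> bounded_ops \<and> (\<forall>x. cinner (blinfun_apply T x) x \<in> \<real>\<^sub>\<ge>\<^sub>0)"

definition commutant :: "'a::complex_hilbert_space op set \<Rightarrow> 'a op set" where
  "commutant S = {T \<in> bounded_ops. \<forall>X\<in>S. T o\<^sub>L X = X o\<^sub>L T}"

text \<open>Closure under the algebra operations and the presence of the identity follow from
  \<open>M = M''\<close>.\<close>

definition von_neumann_algebra :: "'a::complex_hilbert_space op set \<Rightarrow> bool" where
  "von_neumann_algebra M \<longleftrightarrow>
     M \<subseteq> bounded_ops \<and> (\<forall>x\<in>M. adj x \<in> M) \<and> commutant (commutant M) = M"

definition von_neumann_subalgebra ::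
    "'a::complex_hilbert_space op set \<Rightarrow> 'a op set \<Rightarrow> bool" where
  "von_neumann_subalgebra N M \<longleftrightarrow>
     von_neumann_algebra N \<and> von_neumann_algebra M \<and> N \<subseteq> M"

definition factor :: "'a::complex_hilbert_space op set \<Rightarrow> bool" where
  "factor M \<longleftrightarrow> von_neumann_algebra M \<and> (id_blinfun :: 'a op) \<noteq> 0 \<and>
     M \<inter> commutant M = range (\<lambda>c. scaleC_op c id_blinfun)"

definition projections :: "'a::complex_hilbert_space op set \<Rightarrow> 'a op set" where
  "projections M = {p \<in> M. p o\<^sub>L p = p \<and> adj p = p}"

text \<open>Murray-von Neumann equivalence in \<open>M\<close>.\<close>

definition mvn_equiv ::
    "'a::complex_hilbert_space op set \<Rightarrow> 'a op \<Rightarrow> 'a op \<Rightarrow> bool" where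
  "mvn_equiv M p q \<longleftrightarrow> (\<exists>v\<in>M. adj v o\<^sub>L v = p \<and> v o\<^sub>L adj v = q)"

definition finite_projection :: "'a::complex_hilbert_space op set \<Rightarrow> 'a op \<Rightarrow> bool" where
  "finite_projection M p \<longleftrightarrow> p \<in> projections M \<and>
     (\<forall>q\<in>projections M. p o\<^sub>L q = q \<and> mvn_equiv M p q \<longrightarrow> q = p)"

definition abelian_projection :: "'a::complex_hilbert_space op set \<Rightarrow> 'a op \<Rightarrow> bool" where
  "abelian_projection M p \<longleftrightarrow> p \<in> projections M \<and>
     (\<forall>x\<in>M. \<forall>y\<in>M. (p o\<^sub>L x o\<^sub>L p) o\<^sub>L (p o\<^sub>L y o\<^sub>L p)
                 = (p o\<^sub>L y o\<^sub>L p) o\<^sub>L (p o\<^sub>L x o\<^sub>L p))"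

definition type_II1_factor :: "'a::complex_hilbert_space op set \<Rightarrow> bool" where
  "type_II1_factor M \<longleftrightarrow> factor M \<and> finite_projection M id_blinfun \<and>
     (\<forall>p. abelian_projection M p \<longrightarrow> p = 0)"

text \<open>
  Functionals and maps on \<open>M\<close> are total functions; only their values on \<open>M\<close> matter.
\<close>

definition linear_on_alg ::
    "'a::complex_hilbert_space op set \<Rightarrow> ('a op \<Rightarrow> complex) \<Rightarrow> bool" where
  "linear_on_alg M f \<longleftrightarrow> (\<forall>x\<in>M. \<forall>y\<in>M. f (x + y) = f x + f y) \<and>
     (\<forall>c. \<forall>x\<in>M. f (scaleC_op c x) = c * f x)"

definition state :: "'a::complex_hilbert_space op set \<Rightarrow> ('a op \<Rightarrow> complex) \<Rightarrow> bool" where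
  "state M f \<longleftrightarrow> linear_on_alg M f \<and>
     (\<forall>x\<in>M. positive_op x \<longrightarrow> f x \<in> \<real>\<^sub>\<ge>\<^sub>0) \<and> f id_blinfun = 1"

text \<open>
  \<open>f\<close> preserves least upper bounds of upward directed sets \<open>D\<close> of positive elements, where
  \<open>x \<le> y\<close> means that \<open>y - x\<close> is positive.
\<close>

definition normal_on :: "'a::complex_hilbert_space op set \<Rightarrow> ('a op \<Rightarrow> complex) \<Rightarrow> bool" where
  "normal_on M f \<longleftrightarrow> (\<forall>D s. D \<noteq> {} \<and> D \<subseteq> {x\<in>M. positive_op x} \<and>
     (\<forall>x\<in>D. \<forall>y\<in>D. \<exists>z\<in>D. positive_op (z - x) \<and> positive_op (z - y)) \<and>
     s \<in> M \<and> (\<forall>x\<in>D. positive_op (s - x)) \<and>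
     (\<forall>b\<in>M. (\<forall>x\<in>D. positive_op (b - x)) \<longrightarrow> positive_op (b - s))
     \<longrightarrow> Re (f s) = (SUP x\<in>D. Re (f x)))"

definition faithful_normal_tracial_state ::
    "'a::complex_hilbert_space op set \<Rightarrow> ('a op \<Rightarrow> complex) \<Rightarrow> bool" where
  "faithful_normal_tracial_state M tr \<longleftrightarrow> state M tr \<and>
     (\<forall>x\<in>M. \<forall>y\<in>M. tr (x o\<^sub>L y) = tr (y o\<^sub>L x)) \<and>
     (\<forall>x\<in>M. positive_op x \<and> tr x = 0 \<longrightarrow> x = 0) \<and>
     normal_on M tr"

definition norm2 :: "('a::complex_hilbert_space op \<Rightarrow> complex) \<Rightarrow> 'a op \<Rightarrow> real" where
  "norm2 tr x = sqrt (Re (tr (adj x o\<^sub>L x)))"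

text \<open>The supremum is taken in the extended reals, so it is meaningful for every map.\<close>

definition norm_inf_2 ::
    "'a::complex_hilbert_space op set \<Rightarrow> ('a op \<Rightarrow> complex) \<Rightarrow> ('a op \<Rightarrow> 'a op) \<Rightarrow> ereal" where
  "norm_inf_2 M tr \<phi> = (SUP x\<in>{x\<in>M. norm x \<le> 1}. ereal (norm2 tr (\<phi> x)))"

text \<open>
  \<open>E\<close> is the trace preserving conditional expectation of \<open>M\<close> onto \<open>N\<close>: a positive,
  \<open>N\<close>-bimodular linear projection of \<open>M\<close> onto \<open>N\<close> that preserves \<open>tr\<close>. For a
  faithful normal tracial state and a von Neumann subalgebra there is exactly one such map up to
  its values outside \<open>M\<close>, so a quantification over all such \<open>E\<close> concerns this one map.
\<close>

definition trace_preserving_cond_exp ::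
    "'a::complex_hilbert_space op set \<Rightarrow> ('a op \<Rightarrow> complex) \<Rightarrow> 'a op set \<Rightarrow>
     ('a op \<Rightarrow> 'a op) \<Rightarrow> bool" where
  "trace_preserving_cond_exp M tr N E \<longleftrightarrow>
     (\<forall>x\<in>M. E x \<in> N) \<and> (\<forall>x\<in>N. E x = x) \<and>
     (\<forall>x\<in>M. \<forall>y\<in>M. E (x + y) = E x + E y) \<and>
     (\<forall>c. \<forall>x\<in>M. E (scaleC_op c x) = scaleC_op c (E x)) \<and>
     (\<forall>x\<in>M. positive_op x \<longrightarrow> positive_op (E x)) \<and>
     (\<forall>a\<in>N. \<forall>b\<in>N. \<forall>x\<in>M. E (a o\<^sub>L x o\<^sub>L b) = a o\<^sub>L E x o\<^sub>L b) \<and>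
     (\<forall>x\<in>M. tr (E x) = tr x)"

definition unitaries :: "'a::complex_hilbert_space op set \<Rightarrow> 'a op set" where
  "unitaries M = {u \<in> M. adj u o\<^sub>L u = id_blinfun \<and> u o\<^sub>L adj u = id_blinfun}"

definition conjugate :: "'a::complex_hilbert_space op \<Rightarrow> 'a op set \<Rightarrow> 'a op set" where
  "conjugate u A = (\<lambda>a. u o\<^sub>L a o\<^sub>L adj u) ` A"

definition strongly_singular ::
    "'a::complex_hilbert_space op set \<Rightarrow> ('a op \<Rightarrow> complex) \<Rightarrow> 'a op set \<Rightarrow> bool" where
  "strongly_singular M tr A \<longleftrightarrow>
     (\<forall>u\<in>unitaries M. \<forall>E F.
        trace_preserving_cond_exp M tr A E \<and>
        trace_preserving_cond_exp M tr (conjugate u A) F \<longrightarrow>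
        norm_inf_2 M tr (\<lambda>x. E x - F x) \<ge> ereal (norm2 tr (u - E u)))"

end

theory Submission
  imports Defs
begin

text \<open>
  Write \<open>E\<close> for the conditional expectation onto \<open>A\<close> and \<open>F\<close> for the one onto
  \<open>u A u\<^sup>*\<close>, where \<open>u\<close> is a unitary of \<open>M\<close>. The map \<open>E - F\<close> is tested on a single unitary
  \<open>w = u v u\<^sup>*\<close>, with \<open>v\<close> a unitary of \<open>A\<close>. Since \<open>w\<close> lies in \<open>u A u\<^sup>*\<close>, the map \<open>F\<close> fixes
  it, and by the Pythagorean identity for \<open>E\<close>
  (\<open>cond_exp_pythagoras\<close>) the squared distance from \<open>E w\<close> to \<open>F w = w\<close> in the 2-norm is
  one minus the squared norm of \<open>E w\<close>. The hypothesis, applied to the two elements \<open>u\<close> and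
  \<open>u\<^sup>*\<close>, lets \<open>v\<close> be chosen so that \<open>E w\<close> is as close as desired to
  \<open>E(u) v E(u)\<^sup>*\<close>. The 2-norm of this product is at most that of \<open>E u\<close>,
  because left multiplication by \<open>E u\<close> does not increase the 2-norm
  (\<open>norm2_compose_cond_exp_le\<close>), and the remaining factor \<open>v E(u)\<^sup>*\<close> has the norm of \<open>E u\<close>, as \<open>v\<close>
  is unitary and \<open>tr\<close> is tracial. So in the limit the
  squared distance is at least one minus the squared norm of \<open>E u\<close>, and by the Pythagorean
  identity for \<open>u\<close> this is the squared norm of \<open>u - E u\<close>.

  Both auxiliary facts follow from one operator identity (\<open>cond_exp_adj_compose\<close>), the variance
  formula \<open>E((x - E x)\<^sup>*(x - E x)) = E(x\<^sup>*x) - (E x)\<^sup>*(E x)\<close>. The trace of its two sides gives the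
  Pythagorean identity, and the positivity of its left side gives Kadison's inequality
  \<open>(E x)\<^sup>*(E x) \<le> E(x\<^sup>*x)\<close>, by which \<open>E u\<close> is a contraction. The variance formula requires
  \<open>E\<close> to commute with adjoints, which is a consequence of its positivity.
\<close>

section \<open>Adjoints\<close>

text \<open>This serves twice: for the Cauchy--Schwarz inequality, and with \<open>a = 0\<close> as the first-order
  condition at a minimum in \<open>riesz_representation\<close>.\<close>

lemma quadratic_nonneg_discriminant:
  fixes a b c :: real
  assumes nonneg: "\<And>t. 0 \<le> a + 2 * t * b + t\<^sup>2 * c" and c: "0 \<le> c"
  shows "b\<^sup>2 \<le> a * c"
proof (cases "c = 0")
  case True
  have "b = 0"
  proof (rule ccontr)
    assume "b \<noteq> 0"
    then show False
      using nonneg[of "- (a + 1) / (2 * b)"] True by (simp add: field_simps)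
  qed
  then show ?thesis using True by simp
next
  case False
  then have "c > 0" using c by simp
  have "0 \<le> a + 2 * (- b / c) * b + (- b / c)\<^sup>2 * c"
    by (rule nonneg)
  also have "\<dots> = a - b\<^sup>2 / c"
    using False by (simp add: field_simps power2_eq_square)
  finally show ?thesis
    using \<open>c > 0\<close> by (simp add: field_simps)
qed

text \<open>
  The representing vector minimises the quadratic functional \<open>Q x = (norm x)\<^sup>2 - 2 * f x\<close>: by the
  parallelogram law a minimising sequence is Cauchy, and at the minimum the derivative of \<open>Q\<close> in
  the direction \<open>x\<close>, which is twice \<open>inner x z - f x\<close>, vanishes.
\<close>

theorem riesz_representation:
  fixes f :: "'a::{real_inner, complete_space} \<Rightarrow> real"
  assumes "bounded_linear f"
  shows "\<exists>z. \<forall>x. f x = inner x z"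
proof -
  interpret f: bounded_linear f by fact
  obtain K where K: "\<And>x. \<bar>f x\<bar> \<le> norm x * K"
    using f.bounded by auto
  define Q where "Q x = (norm x)\<^sup>2 - 2 * f x" for x
  define m where "m = Inf (range Q)"
  have "- K\<^sup>2 \<le> Q x" for x
  proof -
    have "0 \<le> (norm x - K)\<^sup>2" by simp
    then show ?thesis
      using K[of x] by (simp add: Q_def power2_diff)
  qed
  then have bdd: "bdd_below (range Q)"
    by (auto intro!: bdd_belowI)
  then have m_le: "m \<le> Q x" for x
    unfolding m_def by (rule cInf_lower[rotated]) simp
  have "\<exists>x. Q x < m + inverse (real (Suc n))" for n
    using cInf_lessD[of "range Q" "m + inverse (real (Suc n))"] by (auto simp: m_def)
  then obtain s where s: "\<And>n. Q (s n) < m + inverse (real (Suc n))"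
    by metis
  have close: "(norm (x - y))\<^sup>2 \<le> 2 * (Q x - m) + 2 * (Q y - m)" for x y
  proof -
    define h where "h = (1/2) *\<^sub>R (x + y)"
    have "Q x + Q y - 2 * Q h = (norm (x - y))\<^sup>2 / 2"
      unfolding Q_def h_def
      by (simp add: f.scaleR f.add power2_norm_eq_inner algebra_simps inner_commute)
    then show ?thesis
      using m_le[of h] by argo
  qed
  have "Cauchy s"
  proof (rule metric_CauchyI)
    fix e :: real assume "0 < e"
    then obtain N where N: "inverse (real (Suc N)) < e\<^sup>2 / 4"
      using reals_Archimedean[of "e\<^sup>2 / 4"] by auto
    have "dist (s i) (s j) < e" if "N \<le> i" "N \<le> j" for i j
    proof -
      have "inverse (real (Suc i)) \<le> inverse (real (Suc N))"
        and "inverse (real (Suc j)) \<le> inverse (real (Suc N))"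
        using that by (auto intro!: le_imp_inverse_le)
      then have "(norm (s i - s j))\<^sup>2 < e\<^sup>2"
        using close[of "s i" "s j"] s[of i] s[of j] N by argo
      then show ?thesis
        using \<open>0 < e\<close> by (simp add: dist_norm power_less_imp_less_base)
    qed
    then show "\<exists>N. \<forall>i\<ge>N. \<forall>j\<ge>N. dist (s i) (s j) < e" by blast
  qed
  then obtain z where z: "s \<longlonglongrightarrow> z"
    using Cauchy_convergent convergent_def by blast
  have "(\<lambda>n. Q (s n)) \<longlonglongrightarrow> Q z"
    unfolding Q_def by (intro tendsto_intros f.tendsto z)
  moreover have "(\<lambda>n. m + inverse (real (Suc n))) \<longlonglongrightarrow> m + 0"
    by (intro tendsto_intros LIMSEQ_inverse_real_of_nat)
  ultimately have Qz: "Q z \<le> m"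
    using s by (auto intro: LIMSEQ_le less_imp_le)
  have "f x = inner x z" for x
  proof -
    have "0 \<le> 0 + 2 * t * (inner x z - f x) + t\<^sup>2 * (norm x)\<^sup>2" for t
    proof -
      have "Q (z + t *\<^sub>R x) = Q z + 2 * t * (inner x z - f x) + t\<^sup>2 * (norm x)\<^sup>2"
        unfolding Q_def power2_norm_eq_inner
        by (simp add: f.scaleR f.add algebra_simps inner_commute power2_eq_square)
      then show ?thesis
        using m_le[of "z + t *\<^sub>R x"] Qz by linarith
    qed
    from quadratic_nonneg_discriminant[OF this] show ?thesis by simp
  qed
  then show ?thesis by blast
qed

lemma cinner_scaleC_right: "cinner x (c *\<^sub>C y) = cnj c * cinner x y"
  by (metis cinner_commute cinner_scaleC_left complex_cnj_mult)

lemma cinner_add_right: "cinner x (y + z) = cinner x y + cinner x z"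
  by (metis cinner_commute cinner_add_left complex_cnj_add)

text \<open>The complex inner product is thereby determined by the real one, so that adjoints can be found
  with the real Riesz theorem alone.\<close>

lemma Im_cinner: "Im (cinner x y) = inner ((- \<i>) *\<^sub>C x) y"
  by (simp add: Re_cinner[symmetric] cinner_scaleC_left)

lemma cinner_self: "cinner x x = complex_of_real ((norm x)\<^sup>2)"
proof -
  have "Im (cinner x x) = 0"
    using cinner_commute[of x x] by (simp add: complex_eq_iff)
  then show ?thesis
    by (simp add: complex_eq_iff Re_cinner power2_norm_eq_inner)
qed

lemma cinner_right_cong:
  assumes "\<And>x. cinner x y = cinner x z"
  shows "y = z"
proof -
  have "inner x y = inner x z" for x
    by (metis assms Re_cinner)
  then have "inner (y - z) (y - z) = 0"
    by (metis inner_diff_right diff_self)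
  then show ?thesis by simp
qed

lemma adjoint_exists:
  fixes T :: "'a::complex_hilbert_space op"
  assumes T: "T \<in> bounded_ops"
  shows "\<exists>S. \<forall>x y. cinner (blinfun_apply T x) y = cinner x (blinfun_apply S y)"
proof -
  have "\<exists>z. \<forall>x. inner (blinfun_apply T x) y = inner x z" for y
    by (rule riesz_representation)
      (intro bounded_linear_intros blinfun.bounded_linear_right)
  then obtain S where S: "\<And>x y. inner (blinfun_apply T x) y = inner x (S y)"
    by metis
  have unique: "a = b" if "\<And>x. inner x a = inner x b" for a b :: 'a
    using that[of "a - b"] by (metis inner_diff_right diff_self inner_eq_zero_iff right_minus_eq)
  have "bounded_linear S"
  proof (rule bounded_linear_intro[where K = "norm T"])
    show "S (x + y) = S x + S y" for x y
      by (rule unique) (simp add: S[symmetric] inner_add_right)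
    show "S (r *\<^sub>R x) = r *\<^sub>R S x" for r x
      by (rule unique) (simp add: S[symmetric])
    show "norm (S x) \<le> norm x * norm T" for x
    proof (cases "S x = 0")
      case False
      have "norm (S x) * norm (S x) = inner (blinfun_apply T (S x)) x"
        by (simp add: S dot_square_norm power2_eq_square)
      also have "\<dots> \<le> norm (blinfun_apply T (S x)) * norm x"
        by (rule norm_cauchy_schwarz)
      also have "\<dots> \<le> (norm T * norm (S x)) * norm x"
        by (intro mult_right_mono norm_blinfun) simp
      finally have "norm (S x) * norm (S x) \<le> norm (S x) * (norm x * norm T)"
        by (simp add: mult_ac)
      then show ?thesis using False by simp
    qed simp
  qed
  moreover have "cinner (blinfun_apply T x) y = cinner x (S y)" for x y
  proof (rule complex_eqI)
    show "Re (cinner (blinfun_apply T x) y) = Re (cinner x (S y))"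
      by (simp add: Re_cinner S)
    have "(- \<i>) *\<^sub>C blinfun_apply T x = blinfun_apply T ((- \<i>) *\<^sub>C x)"
      using T by (simp add: bounded_ops_def)
    then show "Im (cinner (blinfun_apply T x) y) = Im (cinner x (S y))"
      by (simp only: Im_cinner S)
  qed
  ultimately show ?thesis
    by (intro exI[of _ "Blinfun S"]) (simp add: bounded_linear_Blinfun_apply)
qed

lemma adj_eqI:
  assumes "\<And>x y. cinner (blinfun_apply T x) y = cinner x (blinfun_apply S y)"
  shows "adj T = S"
  unfolding adj_def
proof (rule the_equality)
  fix R assume "\<forall>x y. cinner (blinfun_apply T x) y = cinner x (blinfun_apply R y)"
  then show "R = S"
    using assms by (intro blinfun_eqI cinner_right_cong) metis
qed (use assms in blast)

lemma cinner_adj_right: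
  assumes "T \<in> bounded_ops"
  shows "cinner x (blinfun_apply (adj T) y) = cinner (blinfun_apply T x) y"
proof -
  obtain S where S: "\<And>x y. cinner (blinfun_apply T x) y = cinner x (blinfun_apply S y)"
    using adjoint_exists[OF assms] by blast
  then have "adj T = S"
    by (rule adj_eqI)
  then show ?thesis
    using S by simp
qed

lemma cinner_adj_left:
  assumes "T \<in> bounded_ops"
  shows "cinner (blinfun_apply (adj T) x) y = cinner x (blinfun_apply T y)"
  using cinner_adj_right[OF assms, of y x]
    cinner_commute[of "blinfun_apply (adj T) x" y] cinner_commute[of x "blinfun_apply T y"]
  by simp

lemma adj_in_bounded_ops:
  assumes "T \<in> bounded_ops"
  shows "adj T \<in> bounded_ops"
proof -
  have "blinfun_apply (adj T) (c *\<^sub>C x) = c *\<^sub>C blinfun_apply (adj T) x" for c x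
    by (rule cinner_right_cong) (simp add: cinner_adj_right assms cinner_scaleC_right)
  then show ?thesis
    by (simp add: bounded_ops_def)
qed

lemma adj_adj: "T \<in> bounded_ops \<Longrightarrow> adj (adj T) = T"
  by (rule adj_eqI) (rule cinner_adj_left)

lemma adj_id: "adj id_blinfun = id_blinfun"
  by (rule adj_eqI) simp

lemma adj_compose:
  assumes "S \<in> bounded_ops" "T \<in> bounded_ops"
  shows "adj (S o\<^sub>L T) = adj T o\<^sub>L adj S"
  by (rule adj_eqI) (simp add: cinner_adj_right assms)

lemma adj_add:
  assumes "S \<in> bounded_ops" "T \<in> bounded_ops"
  shows "adj (S + T) = adj S + adj T"
  by (rule adj_eqI)
    (simp add: cinner_adj_right assms cinner_add_left cinner_add_right blinfun.add_left)

lemma adj_scaleC: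
  assumes "T \<in> bounded_ops"
  shows "adj (scaleC_op c T) = scaleC_op (cnj c) (adj T)"
  by (rule adj_eqI)
    (simp add: cinner_adj_right assms cinner_scaleC_left cinner_scaleC_right scaleC_op.rep_eq)

lemma positive_op_adj_compose:
  assumes "T \<in> bounded_ops"
  shows "positive_op (adj T o\<^sub>L T)"
  using assms adj_in_bounded_ops[OF assms]
  by (auto simp: positive_op_def bounded_ops_def cinner_adj_left[OF assms] cinner_self
      complex_nonneg_Reals_iff)

text \<open>Polarisation. This is where complex scalars matter: over the reals the quadratic form of a
  skew-symmetric operator vanishes.\<close>

lemma op_eqI_quadratic_form:
  fixes S T :: "'a::complex_hilbert_space op"
  assumes S: "S \<in> bounded_ops" and T: "T \<in> bounded_ops"
    and eq: "\<And>x. cinner (blinfun_apply S x) x = cinner (blinfun_apply T x) x"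
  shows "S = T"
proof -
  let ?B = "\<lambda>x y. cinner (blinfun_apply S x) y - cinner (blinfun_apply T x) y"
  have B0: "?B x x = 0" for x
    using eq by simp
  have expand: "?B (x + c *\<^sub>C y) (x + c *\<^sub>C y)
      = ?B x x + cnj c * ?B x y + c * ?B y x + c * cnj c * ?B y y" for c x y
    using S T by (simp add: bounded_ops_def blinfun.add_right cinner_add_left cinner_add_right
        cinner_scaleC_left cinner_scaleC_right algebra_simps)
  have "?B x y = 0" for x y
  proof -
    have sum0: "cnj c * ?B x y + c * ?B y x = 0" for c
      using expand[of x c y] B0[of "x + c *\<^sub>C y"] B0[of x] B0[of y] by simp
    have "?B x y + ?B y x = 0"
      using sum0[of 1] by simp
    moreover have "\<i> * (?B y x - ?B x y) = 0"
      using sum0[of \<i>] by (simp add: algebra_simps)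
    ultimately show ?thesis
      by (simp add: complex_eq_iff)
  qed
  then have "cinner y (blinfun_apply S x) = cinner y (blinfun_apply T x)" for x y
    by (metis cinner_commute right_minus_eq)
  then show ?thesis
    by (intro blinfun_eqI cinner_right_cong)
qed

section \<open>Positive functionals on operator algebras\<close>

text \<open>
  The algebras are \<open>A\<close> and \<open>M\<close>. The positive functionals on \<open>M\<close> include both the trace, which gives
  the 2-norm, and the maps \<open>y \<mapsto> cinner (blinfun_apply (E y) \<xi>) \<xi>\<close>, through which facts about
  functionals carry over to \<open>E\<close>.
\<close>

locale operator_star_algebra =
  fixes M :: "'a::complex_hilbert_space op set"
  assumes bounded: "x \<in> M \<Longrightarrow> x \<in> bounded_ops"
    and id_closed: "id_blinfun \<in> M"
    and add_closed: "x \<in> M \<Longrightarrow> y \<in> M \<Longrightarrow> x + y \<in> M"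
    and scaleC_closed: "x \<in> M \<Longrightarrow> scaleC_op c x \<in> M"
    and compose_closed: "x \<in> M \<Longrightarrow> y \<in> M \<Longrightarrow> x o\<^sub>L y \<in> M"
    and adj_closed: "x \<in> M \<Longrightarrow> adj x \<in> M"

lemma scaleC_op_apply: "blinfun_apply (scaleC_op c T) x = c *\<^sub>C blinfun_apply T x"
  by (simp add: scaleC_op.rep_eq)

lemma scaleC_op_minus_one: "scaleC_op (- 1) x = - x"
  using scaleC_of_real[of "- 1"]
  by (intro blinfun_eqI) (simp add: scaleC_op_apply blinfun.minus_left)

lemma diff_op_eq: "x - y = x + scaleC_op (- 1) y"
  by (simp add: scaleC_op_minus_one)

lemma scaleC_op_one: "scaleC_op 1 x = x"
  using scaleC_of_real[of 1] by (intro blinfun_eqI) (auto simp: scaleC_op_apply)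

lemma scaleC_op_compose_left: "scaleC_op c x o\<^sub>L y = scaleC_op c (x o\<^sub>L y)"
  by (rule blinfun_eqI) (simp add: scaleC_op_apply)

lemma scaleC_op_compose_right:
  "x \<in> bounded_ops \<Longrightarrow> x o\<^sub>L scaleC_op c y = scaleC_op c (x o\<^sub>L y)"
  by (rule blinfun_eqI) (simp add: scaleC_op_apply bounded_ops_def)

lemma compose_op_assoc:
  "(x o\<^sub>L y) o\<^sub>L z = x o\<^sub>L (y o\<^sub>L (z::'a::real_normed_vector \<Rightarrow>\<^sub>L 'a))"
  by (rule blinfun_eqI) simp

lemma compose_id_left: "id_blinfun o\<^sub>L x = x"
  and compose_id_right: "x o\<^sub>L id_blinfun = x"
  by (rule blinfun_eqI; simp)+

lemma compose_add_left: "(x + y) o\<^sub>L z = (x o\<^sub>L z) + (y o\<^sub>L (z::'a::real_normed_vector \<Rightarrow>\<^sub>L 'a))"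
  by (rule blinfun_eqI) (simp add: blinfun.add_left)

lemma compose_add_right: "z o\<^sub>L (x + y) = (z o\<^sub>L x) + (z o\<^sub>L (y::'a::real_normed_vector \<Rightarrow>\<^sub>L 'a))"
  by (rule blinfun_eqI) (simp add: blinfun.add_left blinfun.add_right)

lemma von_neumann_algebra_imp_star_algebra:
  assumes "von_neumann_algebra M"
  shows "operator_star_algebra M"
proof -
  obtain C where C: "M = commutant C"
    using assms by (auto simp: von_neumann_algebra_def)
  have scaleC_comm: "c *\<^sub>C d *\<^sub>C x = d *\<^sub>C c *\<^sub>C x" for c d and x :: 'a
    by (simp add: scaleC_scaleC mult.commute)
  show ?thesis
  proof
    show "x \<in> M \<Longrightarrow> x \<in> bounded_ops" for x
      using assms by (auto simp: von_neumann_algebra_def)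
    show "x \<in> M \<Longrightarrow> adj x \<in> M" for x
      using assms by (auto simp: von_neumann_algebra_def)
    show "id_blinfun \<in> M"
      unfolding C commutant_def bounded_ops_def by (auto intro!: blinfun_eqI)
    show "x + y \<in> M" if "x \<in> M" "y \<in> M" for x y
      using that unfolding C commutant_def bounded_ops_def
      by (auto simp: compose_add_left compose_add_right blinfun.add_left scaleC_add_right)
    show "x o\<^sub>L y \<in> M" if "x \<in> M" "y \<in> M" for x y
    proof -
      have "(x o\<^sub>L y) o\<^sub>L X = X o\<^sub>L (x o\<^sub>L y)" if "X \<in> C" for X
      proof -
        have "x o\<^sub>L X = X o\<^sub>L x" "y o\<^sub>L X = X o\<^sub>L y"
          using \<open>x \<in> M\<close> \<open>y \<in> M\<close> that by (auto simp: C commutant_def)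
        then show ?thesis
          by (metis compose_op_assoc)
      qed
      then show ?thesis
        using that unfolding C commutant_def bounded_ops_def by simp
    qed
    (* The members of C need not be complex linear and so need not commute with scalars; the
       elements of the commutant of M are complex linear, so the double commutant is used here. *)
    show "scaleC_op c x \<in> M" if "x \<in> M" for c x
    proof -
      have x: "x \<in> commutant (commutant M)"
        using that assms by (simp add: von_neumann_algebra_def)
      then have "scaleC_op c x \<in> commutant (commutant M)"
        by (auto simp: commutant_def scaleC_op_compose_left scaleC_op_compose_right)
          (auto simp: bounded_ops_def scaleC_op_apply scaleC_comm)
      then show ?thesis
        using assms by (simp add: von_neumann_algebra_def)
    qed
  qed
qed

locale positive_functional = operator_star_algebra +
  fixes f
  assumes linear: "linear_on_alg M f"
    and positive: "x \<in> M \<Longrightarrow> positive_op x \<Longrightarrow> f x \<in> \<real>\<^sub>\<ge>\<^sub>0"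
begin

lemma f_add: "x \<in> M \<Longrightarrow> y \<in> M \<Longrightarrow> f (x + y) = f x + f y"
  and f_scaleC: "x \<in> M \<Longrightarrow> f (scaleC_op c x) = c * f x"
  using linear by (auto simp: linear_on_alg_def)

lemma f_adj_compose_nonneg: "x \<in> M \<Longrightarrow> f (adj x o\<^sub>L x) \<in> \<real>\<^sub>\<ge>\<^sub>0"
  by (intro positive positive_op_adj_compose compose_closed adj_closed bounded)

lemma f_adj_compose_add:
  assumes x: "x \<in> M" and y: "y \<in> M"
  shows "f (adj (x + scaleC_op c y) o\<^sub>L (x + scaleC_op c y))
      = f (adj x o\<^sub>L x) + c * f (adj x o\<^sub>L y) + cnj c * f (adj y o\<^sub>L x)
        + c * cnj c * f (adj y o\<^sub>L y)"
  using x y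
  by (simp add: adj_add adj_scaleC bounded compose_add_left compose_add_right
      scaleC_op_compose_left scaleC_op_compose_right f_add f_scaleC
      scaleC_closed add_closed compose_closed adj_closed algebra_simps)

text \<open>Positivity makes the value at \<open>(x + c y)\<^sup>*(x + c y)\<close> real for every complex \<open>c\<close>. The choices
  \<open>c = 1\<close> and \<open>c = \<i>\<close> compare the imaginary and the real parts.\<close>

lemma f_adj_compose_commute:
  assumes x: "x \<in> M" and y: "y \<in> M"
  shows "f (adj y o\<^sub>L x) = cnj (f (adj x o\<^sub>L y))"
proof -
  have real: "Im (f (adj z o\<^sub>L z)) = 0" if "z \<in> M" for z
    using f_adj_compose_nonneg[OF that] by (simp add: complex_nonneg_Reals_iff)
  have im: "Im (c * f (adj x o\<^sub>L y) + cnj c * f (adj y o\<^sub>L x)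
      + c * cnj c * f (adj y o\<^sub>L y)) = 0" for c
    using f_adj_compose_add[OF x y, of c] real[of "x + scaleC_op c y"] real[OF x]
    by (simp add: x y add_closed scaleC_closed)
  show ?thesis
    using im[of 1] im[of \<i>] real[OF y] by (simp add: complex_eq_iff)
qed

lemma f_adj: "x \<in> M \<Longrightarrow> f (adj x) = cnj (f x)"
  using f_adj_compose_commute[of id_blinfun x] by (simp add: id_closed adj_id compose_id_left compose_id_right)

lemma norm2_power2: "x \<in> M \<Longrightarrow> (norm2 f x)\<^sup>2 = Re (f (adj x o\<^sub>L x))"
  using f_adj_compose_nonneg by (simp add: norm2_def complex_nonneg_Reals_iff)

lemma norm2_nonneg: "x \<in> M \<Longrightarrow> 0 \<le> norm2 f x"
  using f_adj_compose_nonneg by (simp add: norm2_def complex_nonneg_Reals_iff)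

lemma cauchy_schwarz:
  assumes x: "x \<in> M" and y: "y \<in> M"
  shows "\<bar>Re (f (adj x o\<^sub>L y))\<bar> \<le> norm2 f x * norm2 f y"
proof -
  have "(Re (f (adj x o\<^sub>L y)))\<^sup>2 \<le> (norm2 f x)\<^sup>2 * (norm2 f y)\<^sup>2"
  proof (rule quadratic_nonneg_discriminant)
    fix t :: real
    let ?z = "x + scaleC_op (of_real t) y"
    have "0 \<le> (norm2 f ?z)\<^sup>2" by simp
    also have "\<dots> = (norm2 f x)\<^sup>2 + 2 * t * Re (f (adj x o\<^sub>L y)) + t\<^sup>2 * (norm2 f y)\<^sup>2"
      using f_adj_compose_commute[OF x y]
      by (simp add: norm2_power2 x y add_closed scaleC_closed f_adj_compose_add[OF x y])
        (simp add: power2_eq_square)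
    finally show "0 \<le> (norm2 f x)\<^sup>2 + 2 * t * Re (f (adj x o\<^sub>L y)) + t\<^sup>2 * (norm2 f y)\<^sup>2" .
  qed simp
  then show ?thesis
    using norm2_nonneg[OF x] norm2_nonneg[OF y]
    by (metis abs_le_square_iff abs_of_nonneg mult_nonneg_nonneg power_mult_distrib)
qed

lemma norm2_triangle:
  assumes x: "x \<in> M" and y: "y \<in> M"
  shows "norm2 f (x + y) \<le> norm2 f x + norm2 f y"
proof (rule power2_le_imp_le)
  have "(norm2 f (x + y))\<^sup>2 = (norm2 f x)\<^sup>2 + 2 * Re (f (adj x o\<^sub>L y)) + (norm2 f y)\<^sup>2"
    using f_adj_compose_add[OF x y, of 1] f_adj_compose_commute[OF x y]
    by (simp add: norm2_power2 x y add_closed scaleC_op_one)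
  also have "\<dots> \<le> (norm2 f x + norm2 f y)\<^sup>2"
    using cauchy_schwarz[OF x y] by (simp add: power2_sum)
  finally show "(norm2 f (x + y))\<^sup>2 \<le> (norm2 f x + norm2 f y)\<^sup>2" .
  show "0 \<le> norm2 f x + norm2 f y"
    using norm2_nonneg x y by simp
qed

lemma diff_closed: "x \<in> M \<Longrightarrow> y \<in> M \<Longrightarrow> x - y \<in> M"
  by (simp add: diff_op_eq add_closed scaleC_closed)

lemma f_diff: "x \<in> M \<Longrightarrow> y \<in> M \<Longrightarrow> f (x - y) = f x - f y"
  by (simp add: diff_op_eq f_add f_scaleC scaleC_closed)

lemma norm2_minus_commute:
  assumes "x \<in> M" "y \<in> M"
  shows "norm2 f (x - y) = norm2 f (y - x)"
proof -
  have "x - y = scaleC_op (- 1) (y - x)"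
    using diff_op_eq[of 0 "y - x"] by simp
  then have "adj (x - y) o\<^sub>L (x - y) = adj (y - x) o\<^sub>L (y - x)"
    using diff_closed[OF assms(2,1)]
    by (simp add: adj_scaleC bounded scaleC_op_compose_left scaleC_op_compose_right
        adj_closed) (auto intro!: blinfun_eqI simp: scaleC_op_apply scaleC_scaleC
        scaleC_of_real[of 1, simplified])
  then show ?thesis by (simp add: norm2_def)
qed

end

section \<open>Trace preserving conditional expectations\<close>

text \<open>For every vector \<open>\<xi>\<close> the map \<open>y \<mapsto> cinner (blinfun_apply (E y) \<xi>) \<xi>\<close> is a positive functional,
  hence hermitian, so both operators have the same quadratic form.\<close>

lemma cond_exp_adj:
  assumes M: "operator_star_algebra M" and N: "operator_star_algebra N"
    and E: "trace_preserving_cond_exp M tr N E" and x: "x \<in> M"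
  shows "E (adj x) = adj (E x)"
proof -
  interpret M: operator_star_algebra M by fact
  interpret N: operator_star_algebra N by fact
  have EN: "E y \<in> bounded_ops" if "y \<in> M" for y
    using E that N.bounded by (auto simp: trace_preserving_cond_exp_def)
  have "cinner (blinfun_apply (E (adj x)) \<xi>) \<xi> = cinner (blinfun_apply (adj (E x)) \<xi>) \<xi>" for \<xi>
  proof -
    interpret positive_functional M "\<lambda>y. cinner (blinfun_apply (E y) \<xi>) \<xi>"
      by unfold_locales
        (use E in \<open>auto simp: trace_preserving_cond_exp_def linear_on_alg_def positive_op_def
          blinfun.add_left cinner_add_left scaleC_op_apply cinner_scaleC_left\<close>)
    show ?thesis
      using f_adj[OF x] by (simp add: cinner_adj_left[OF EN[OF x]]) (metis cinner_commute)
  qed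
  then show ?thesis
    by (intro op_eqI_quadratic_form EN adj_in_bounded_ops M.adj_closed x)
qed

text \<open>With \<open>a = E x\<close>, the bimodule property and \<open>cond_exp_adj\<close> give each of \<open>a\<^sup>*x\<close>, \<open>x\<^sup>*a\<close> and
  \<open>a\<^sup>*a\<close> the same expectation \<open>a\<^sup>*a\<close>.\<close>

lemma cond_exp_adj_compose:
  assumes M: "operator_star_algebra M" and N: "operator_star_algebra N"
    and sub: "N \<subseteq> M"
    and E: "trace_preserving_cond_exp M tr N E" and x: "x \<in> M"
  shows "E (adj (x - E x) o\<^sub>L (x - E x)) = E (adj x o\<^sub>L x) - (adj (E x) o\<^sub>L E x)"
proof -
  interpret M: operator_star_algebra M by fact
  interpret N: operator_star_algebra N by fact
  let ?a = "E x"
  have a: "?a \<in> N" "?a \<in> M"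
    using E x sub by (auto simp: trace_preserving_cond_exp_def)
  have Eadd: "E (y + z) = E y + E z" if "y \<in> M" "z \<in> M" for y z
    using E that by (auto simp: trace_preserving_cond_exp_def)
  have Esc: "E (scaleC_op c y) = scaleC_op c (E y)" if "y \<in> M" for c y
    using E that by (auto simp: trace_preserving_cond_exp_def)
  have bim: "E (b o\<^sub>L y o\<^sub>L c) = b o\<^sub>L E y o\<^sub>L c" if "b \<in> N" "c \<in> N" "y \<in> M" for b c y
    using E that by (auto simp: trace_preserving_cond_exp_def)
  have left: "E (adj ?a o\<^sub>L x) = adj ?a o\<^sub>L ?a"
    using bim[of "adj ?a" id_blinfun x] a x by (simp add: N.id_closed N.adj_closed compose_id_right)
  have right: "E (adj x o\<^sub>L ?a) = adj ?a o\<^sub>L ?a"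
    using bim[of id_blinfun ?a "adj x"] a x cond_exp_adj[OF M N E x]
    by (simp add: N.id_closed M.adj_closed compose_id_left)
  have both: "E (adj ?a o\<^sub>L ?a) = adj ?a o\<^sub>L ?a"
    using E a by (simp add: trace_preserving_cond_exp_def N.compose_closed N.adj_closed)
  have "adj (x - ?a) o\<^sub>L (x - ?a) = ((adj x o\<^sub>L x) + scaleC_op (- 1) (adj ?a o\<^sub>L x))
      + (scaleC_op (- 1) (adj x o\<^sub>L ?a) + (adj ?a o\<^sub>L ?a))"
    using a x
    by (simp add: diff_op_eq adj_add adj_scaleC M.bounded M.scaleC_closed M.adj_closed
        compose_add_left compose_add_right scaleC_op_compose_left scaleC_op_compose_right)
      (auto intro!: blinfun_eqI simp: scaleC_op_apply scaleC_scaleC blinfun.add_left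
        scaleC_of_real[of 1, simplified])
  then show ?thesis
    using a x left right both
    by (simp add: Eadd Esc M.add_closed M.scaleC_closed M.compose_closed M.adj_closed)
      (simp add: scaleC_op_minus_one)
qed

lemma cond_exp_pythagoras:
  assumes M: "operator_star_algebra M" and N: "operator_star_algebra N"
    and sub: "N \<subseteq> M" and tr: "positive_functional M tr"
    and E: "trace_preserving_cond_exp M tr N E" and x: "x \<in> M"
  shows "(norm2 tr (x - E x))\<^sup>2 = (norm2 tr x)\<^sup>2 - (norm2 tr (E x))\<^sup>2"
proof -
  interpret tr: positive_functional M tr by fact
  have a: "E x \<in> M"
    using E x sub by (auto simp: trace_preserving_cond_exp_def)
  have trE: "tr (E y) = tr y" "E y \<in> M" if "y \<in> M" for y
    using E that sub by (auto simp: trace_preserving_cond_exp_def)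
  have d: "x - E x \<in> M"
    using x a by (rule tr.diff_closed)
  have "tr (adj (x - E x) o\<^sub>L (x - E x)) = tr (E (adj (x - E x) o\<^sub>L (x - E x)))"
    using d by (simp add: trE tr.compose_closed tr.adj_closed)
  also have "\<dots> = tr (adj x o\<^sub>L x) - tr (adj (E x) o\<^sub>L E x)"
    using x a by (simp add: cond_exp_adj_compose[OF M N sub E x] tr.f_diff trE
        tr.compose_closed tr.adj_closed)
  finally show ?thesis
    by (simp add: tr.norm2_power2 d x a)
qed

lemma positive_op_conj:
  assumes T: "positive_op T" and w: "w \<in> bounded_ops"
  shows "positive_op (adj w o\<^sub>L T o\<^sub>L w)"
  using T w adj_in_bounded_ops[OF w]
  by (auto simp: positive_op_def bounded_ops_def cinner_adj_left[OF w])

text \<open>The variance formula shows that \<open>1 - (E u)\<^sup>*(E u)\<close> is positive. Conjugating by \<open>w\<close> and taking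
  the trace then compares the two 2-norms directly, without the operator norm of \<open>E u\<close>.\<close>

lemma norm2_compose_cond_exp_le:
  assumes M: "operator_star_algebra M" and N: "operator_star_algebra N"
    and sub: "N \<subseteq> M" and tr: "positive_functional M tr"
    and E: "trace_preserving_cond_exp M tr N E"
    and u: "u \<in> M" "adj u o\<^sub>L u = id_blinfun" and w: "w \<in> M"
  shows "norm2 tr (E u o\<^sub>L w) \<le> norm2 tr w"
proof -
  interpret tr: positive_functional M tr by fact
  interpret N: operator_star_algebra N by fact
  have a: "E u \<in> M"
    using E u sub by (auto simp: trace_preserving_cond_exp_def)
  let ?d = "u - E u"
  have d: "?d \<in> M"
    using u a by (intro tr.diff_closed)
  have "E id_blinfun = id_blinfun"
    using E N.id_closed by (simp add: trace_preserving_cond_exp_def)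
  then have "E (adj ?d o\<^sub>L ?d) = id_blinfun - (adj (E u) o\<^sub>L E u)"
    by (simp add: cond_exp_adj_compose[OF M N sub E u(1)] u(2))
  moreover have "positive_op (E (adj ?d o\<^sub>L ?d))"
    using E d positive_op_adj_compose[OF tr.bounded[OF d]]
    by (simp add: trace_preserving_cond_exp_def tr.compose_closed tr.adj_closed)
  ultimately have pos: "positive_op (adj w o\<^sub>L (id_blinfun - (adj (E u) o\<^sub>L E u)) o\<^sub>L w)"
    using positive_op_conj tr.bounded[OF w] by metis
  have "adj w o\<^sub>L (id_blinfun - (adj (E u) o\<^sub>L E u)) o\<^sub>L w
      = (adj w o\<^sub>L w) - (adj (E u o\<^sub>L w) o\<^sub>L (E u o\<^sub>L w))"
    using w a by (intro blinfun_eqI)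
      (simp add: adj_compose tr.bounded blinfun.diff_left blinfun.diff_right)
  then have "tr ((adj w o\<^sub>L w) - (adj (E u o\<^sub>L w) o\<^sub>L (E u o\<^sub>L w))) \<in> \<real>\<^sub>\<ge>\<^sub>0"
    using pos w a
    by (intro tr.positive tr.diff_closed tr.compose_closed tr.adj_closed) simp_all
  then have "Re (tr (adj (E u o\<^sub>L w) o\<^sub>L (E u o\<^sub>L w))) \<le> Re (tr (adj w o\<^sub>L w))"
    using w a by (simp add: tr.f_diff tr.compose_closed tr.adj_closed complex_nonneg_Reals_iff)
  then show ?thesis
    by (simp add: norm2_def)
qed

text \<open>This places the test unitary in the unit ball over which \<open>norm_inf_2\<close> takes its supremum.\<close>

lemma norm_isometry_le:
  assumes w: "w \<in> bounded_ops" and "adj w o\<^sub>L w = id_blinfun"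
  shows "norm w \<le> 1"
proof (rule norm_blinfun_bound)
  fix x
  have "cinner (blinfun_apply w x) (blinfun_apply w x) = cinner (blinfun_apply (adj w o\<^sub>L w) x) x"
    by (simp add: cinner_adj_left[OF w])
  then have "(norm (blinfun_apply w x))\<^sup>2 = (norm x)\<^sup>2"
    by (simp add: assms(2) cinner_self del: of_real_power)
  then show "norm (blinfun_apply w x) \<le> 1 * norm x"
    by (simp add: power2_eq_iff_nonneg)
qed simp

section \<open>Strong singularity\<close>

theorem lemma2p1:
  fixes M A :: "'a::complex_hilbert_space op set"
    and tr :: "'a op \<Rightarrow> complex"
  assumes "type_II1_factor M"
    and "faithful_normal_tracial_state M tr"
    and "von_neumann_subalgebra A M"
    and "\<And>E \<epsilon> X Y. trace_preserving_cond_exp M tr A E \<Longrightarrow> (\<epsilon>::real) > 0 \<Longrightarrow>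
           finite X \<Longrightarrow> X \<subseteq> M \<Longrightarrow> finite Y \<Longrightarrow> Y \<subseteq> M \<Longrightarrow>
           \<exists>v\<in>unitaries A. \<forall>x\<in>X. \<forall>y\<in>Y.
             norm2 tr (E (x o\<^sub>L v o\<^sub>L y) - (E x o\<^sub>L v o\<^sub>L E y)) < \<epsilon>"
  shows "strongly_singular M tr A"
proof -
  have A: "operator_star_algebra A" and M: "operator_star_algebra M" and sub: "A \<subseteq> M"
    using assms(3) von_neumann_algebra_imp_star_algebra
    by (auto simp: von_neumann_subalgebra_def)
  interpret M: operator_star_algebra M by fact
  have tr: "positive_functional M tr"
    using assms(2)
    by unfold_locales (auto simp: faithful_normal_tracial_state_def state_def)
  interpret tr: positive_functional M tr by fact
  have tr_commute: "tr (x o\<^sub>L y) = tr (y o\<^sub>L x)" if "x \<in> M" "y \<in> M" for x y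
    using assms(2) that by (auto simp: faithful_normal_tracial_state_def)
  have tr_id: "tr id_blinfun = 1"
    using assms(2) by (simp add: faithful_normal_tracial_state_def state_def)
  have norm2_isometry: "(norm2 tr w)\<^sup>2 = 1" if "w \<in> M" "adj w o\<^sub>L w = id_blinfun" for w
    using that by (simp add: tr.norm2_power2 tr_id)
  show ?thesis
    unfolding strongly_singular_def
  proof (intro ballI allI impI, elim conjE)
    fix u E F
    assume u: "u \<in> unitaries M"
      and E: "trace_preserving_cond_exp M tr A E"
      and F: "trace_preserving_cond_exp M tr (conjugate u A) F"
    from u have uM: "u \<in> M" and u1: "adj u o\<^sub>L u = id_blinfun"
      by (auto simp: unitaries_def)
    have EM: "E x \<in> M" if "x \<in> M" for x
      using E that sub by (auto simp: trace_preserving_cond_exp_def)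
    define r where "r = norm2 tr (E u)"
    have distance: "norm2 tr (u - E u) = sqrt (1 - r\<^sup>2)"
      using cond_exp_pythagoras[OF M A sub tr E uM] norm2_isometry[OF uM u1]
        tr.norm2_nonneg[OF tr.diff_closed[OF uM EM[OF uM]]]
      by (simp add: r_def real_sqrt_unique)
    (* The radicand may be negative; sqrt is then negative as well and the bound is trivial. *)
    have approx: "ereal (sqrt (1 - (r + \<epsilon>)\<^sup>2)) \<le> norm_inf_2 M tr (\<lambda>x. E x - F x)"
      if "\<epsilon> > 0" for \<epsilon>
    proof -
      obtain v where v: "v \<in> unitaries A"
        and close: "norm2 tr (E (u o\<^sub>L v o\<^sub>L adj u) - (E u o\<^sub>L v o\<^sub>L E (adj u))) < \<epsilon>"
        using assms(4)[OF E \<open>\<epsilon> > 0\<close>, of "{u}" "{adj u}"] uM M.adj_closed by auto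
      have vM: "v \<in> M" and vA: "v \<in> A" and v1: "adj v o\<^sub>L v = id_blinfun"
        using v sub by (auto simp: unitaries_def)
      define w where "w = u o\<^sub>L v o\<^sub>L adj u"
      have wM: "w \<in> M"
        unfolding w_def using uM vM by (intro M.compose_closed M.adj_closed)
      have w1: "adj w o\<^sub>L w = id_blinfun"
      proof -
        have "adj w o\<^sub>L w = u o\<^sub>L (adj v o\<^sub>L ((adj u o\<^sub>L u) o\<^sub>L v)) o\<^sub>L adj u"
          unfolding w_def using uM vM
          by (simp add: adj_compose adj_adj M.bounded M.compose_closed M.adj_closed
              compose_op_assoc)
        also have "\<dots> = id_blinfun"
          using u by (simp add: u1 v1 unitaries_def compose_id_left compose_id_right)
        finally show ?thesis .
      qed
      have Fw: "F w = w"
        using F vA by (auto simp: trace_preserving_cond_exp_def conjugate_def w_def)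
      let ?p = "E u o\<^sub>L (v o\<^sub>L adj (E u))"
      have pM: "?p \<in> M"
        using uM vM by (intro M.compose_closed M.adj_closed EM)
      have "norm2 tr ?p \<le> norm2 tr (v o\<^sub>L adj (E u))"
        using uM vM u1
        by (intro norm2_compose_cond_exp_le[OF M A sub tr E] M.compose_closed M.adj_closed EM)
      (* Here v cancels, and traciality turns the norm of the adjoint of E u into that of E u. *)
      also have "\<dots> = r"
      proof -
        have "adj (v o\<^sub>L adj (E u)) o\<^sub>L (v o\<^sub>L adj (E u))
            = E u o\<^sub>L ((adj v o\<^sub>L v) o\<^sub>L adj (E u))"
          using uM vM EM
          by (simp add: adj_compose adj_adj M.bounded M.adj_closed compose_op_assoc)
        then show ?thesis
          using tr_commute[of "E u" "adj (E u)"] uM EM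
          by (simp add: norm2_def r_def v1 M.adj_closed compose_id_left)
      qed
      finally have p: "norm2 tr ?p \<le> r" .
      have "norm2 tr (E w - ?p) < \<epsilon>"
        using close by (simp add: w_def cond_exp_adj[OF M A E uM] compose_op_assoc)
      moreover have "norm2 tr (E w) \<le> norm2 tr (E w - ?p) + norm2 tr ?p"
        using tr.norm2_triangle[of "E w - ?p" ?p] tr.diff_closed EM[OF wM] pM by simp
      ultimately have "norm2 tr (E w) \<le> r + \<epsilon>"
        using p by simp
      then have "(norm2 tr (E w))\<^sup>2 \<le> (r + \<epsilon>)\<^sup>2"
        using tr.norm2_nonneg[OF EM[OF wM]] by (intro power_mono)
      then have "1 - (r + \<epsilon>)\<^sup>2 \<le> (norm2 tr (w - E w))\<^sup>2"
        using cond_exp_pythagoras[OF M A sub tr E wM] norm2_isometry[OF wM w1] by simp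
      then have "sqrt (1 - (r + \<epsilon>)\<^sup>2) \<le> norm2 tr (w - E w)"
        using tr.norm2_nonneg[OF tr.diff_closed[OF wM EM[OF wM]]] by (simp add: real_le_lsqrt)
      also have "\<dots> = norm2 tr (E w - F w)"
        using tr.norm2_minus_commute[OF wM EM[OF wM]] by (simp add: Fw)
      finally have "ereal (sqrt (1 - (r + \<epsilon>)\<^sup>2)) \<le> ereal (norm2 tr (E w - F w))"
        by simp
      also have "\<dots> \<le> norm_inf_2 M tr (\<lambda>x. E x - F x)"
        unfolding norm_inf_2_def using wM norm_isometry_le[OF M.bounded[OF wM] w1]
        by (intro SUP_upper) simp
      finally show ?thesis .
    qed
    have "(\<lambda>n. sqrt (1 - (r + inverse (real (Suc n)))\<^sup>2)) \<longlonglongrightarrow> sqrt (1 - (r + 0)\<^sup>2)"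
      by (intro tendsto_intros LIMSEQ_inverse_real_of_nat)
    then have "(\<lambda>n. ereal (sqrt (1 - (r + inverse (real (Suc n)))\<^sup>2))) \<longlonglongrightarrow> ereal (sqrt (1 - r\<^sup>2))"
      by simp
    then have "ereal (sqrt (1 - r\<^sup>2)) \<le> norm_inf_2 M tr (\<lambda>x. E x - F x)"
      by (rule LIMSEQ_le_const2) (intro exI[of _ 0] allI impI approx, simp)
    then show "ereal (norm2 tr (u - E u)) \<le> norm_inf_2 M tr (\<lambda>x. E x - F x)"
      by (simp add: distance)
  qed
qed

end
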